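(* Consider the Galerkin discrete control Hamiltonian (constructed as in the context) $$\hat H_{\rm d}^{+}(q_k,p_{k+1},U_k^1,\dots,U_k^s)=p_{k+1}\cdot f_{\rm d}(q_k,U_k^1,\dots,U_k^s)-C_{\rm d}(q_k,U_k^1,\dots,U_k^s),$$ with $$f_{\rm d}(q_k,U_k^1,\dots,U_k^s)=q_k+h\sum_{i=1}^{s}\tilde w^{i}(q_k,U_k^1,\dots,U_k^s)\,B_i,$$ $$C_{\rm d}(q_k,U_k^1,\dots,U_k^s)=h\sum_{i=1}^{s}b_i\,C\big(Q^{i}(\tilde w(q_k,U_k^1,\dots,U_k^s)),U_k^{i}\big).$$ Assume that $$\frac{\partial}{\partial U_k^{i}}\hat H_{\rm d}^{+}(q_k,p_{k+1},U_k^1,\dots,U_k^s)=0,\qquad i=1,\dots,s,$$ is solvable for $\{U_k^{i}\}_{i=1}^{s}$ to give the optimal internal-stage controls $\{U_k^{*,i}\}_{i=1}^{s}$. Then the right discrete Hamilton--Jacobi equation $$S_{\rm d}^{k+1}(f^{+}_{k}(q))-S_{\rm d}^{k}(q)-DS_{\rm d}^{k+1}(f^{+}_{k}(q))\cdot f^{+}_{k}(q)+H_{\rm d}^{+}\big(q,DS_{\rm d}^{k+1}(f^{+}_{k}(q))\big)=0$$ applied to this case gives the Bellman equation with internal-stage controls for the optimal cost-to-go function $J_{\rm d}^{k}=S_{\rm d}^{*}-S_{\rm d}^{k}$: $$\min_{U_k^{1},\dots,U_k^{s}}\left[J_{\rm d}^{k+1}\big(f_{\rm d}(q_k,U_k^1,\dots,U_k^s)\big)+C_{\rm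 d}(q_k,U_k^1,\dots,U_k^s)\right]=J_{\rm d}^{k}(q_k).$$
   Context: Continuous-time problem: minimize $\int_0^T C(q(t),u(t))\,dt$ subject to $\dot q=f(q,u)$, $q(0)=q_0$, $q(T)=q_T$, where $q$ is in a vector space $V\cong\mathbb{R}^n$, $u$ is in a set $\mathcal{U}\subset\mathbb{R}^m$, $C:V\times\mathcal{U}\to\mathbb{R}$, and $f$ takes values in $V$. The control Hamiltonian is $\hat H(q,p,u)=p\cdot f(q,u)-C(q,u)$, $p\in V^*$. $D_i$ is the derivative in the $i$-th argument, $D$ the derivative of a function of one argument, and $\cdot$ the pairing of $V^*$ with $V$. Galerkin construction: $h$ is the time step, $\psi_1,\dots,\psi_s:[0,1]\to\mathbb{R}$ are basis functions, and $(b_i,c^i)$, $i=1,\dots,s$, with $b_i\neq0$, are the constants of a quadrature formula $\int_0^1 g(\rho)\,d\rho\approx\sum_{i=1}^{s}b_i\,g(c^i)$. Put $B_i=\int_0^1\psi_i(\tau)\,d\tau$, $A^i_j=\int_0^{c^i}\psi_j(\tau)\,d\tau$, $M^i_j=\psi_j(c^i)$. For $w=(w^1,\dots,w^s)$ with $w^i\in V$, the velocity on a step starting at $q_k$ is approximated by $\sum_i w^i\psi_i$, with internal stages $Q^{i}(w)=q_k+h\sum_{j=1}^{s}A^i_j w^j$ (depending also on $q_k$); $U_k^{i}=u(t_k+c^{i}h)$ are the internal-stage controls on the step starting at time $t_k$, and $P^i\in V^*$ are internal-stage momenta. The Galerkin discrete control Hamiltonian is the extremum over $w$ and $P$ of $$K=p_{k+1}\cdot\Big(q_k+h\sum_{i=1}^{s}B_iw^i\Big)-h\sum_{i=1}^{s}b_i\Big\{P^i\cdot\Big[\sum_{j=1}^{s}M^i_jw^j-f(Q^i(w),U_k^i)\Big]+C(Q^i(w),U_k^i)\Big\}$$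 with $q_k$, $p_{k+1}$ and $U_k^1,\dots,U_k^s$ fixed. The stationarity conditions of $K$ in $w$ and $P$ are solved for $w$ and $P$; those in $P$ read $\sum_{j=1}^{s}M^i_jw^j=f(Q^i(w),U_k^i)$, $i=1,\dots,s$, and determine $w=\tilde w(q_k,U_k^1,\dots,U_k^s)$. Substituting, the $P^i$ disappear and $\hat H_{\rm d}^{+}$ takes the form in the claim. Hamilton--Jacobi setting: $H_{\rm d}^{+}(q_k,p_{k+1})=\max_{U_k^1,\dots,U_k^s}\hat H_{\rm d}^{+}(q_k,p_{k+1},U_k^1,\dots,U_k^s)$, attained at the optimal internal-stage controls $U_k^{*,i}=U_k^{*,i}(q_k,p_{k+1})$. The action sums are $S_{\rm d}^{k}(q_k)=\sum_{l=0}^{k-1}[p_{l+1}\cdot q_{l+1}-H_{\rm d}^{+}(q_l,p_{l+1})]$, evaluated along a solution of the right discrete Hamilton's equations $q_{k+1}=D_2H_{\rm d}^{+}(q_k,p_{k+1})$, $p_k=D_1H_{\rm d}^{+}(q_k,p_{k+1})$ and seen as functions of the end point $q_k$ and the discrete end time $k$; $S_{\rm d}^{*}=\sum_{k=0}^{N-1}[p_{k+1}\cdot q_{k+1}-H_{\rm d}^{+}(q_k,p_{k+1})]$ is the optimal discrete cost; and $J_{\rm d}^{k}(q_k)=\sum_{l=k}^{N-1}[p_{l+1}\cdot q_{l+1}-H_{\rm d}^{+}(q_l,p_{l+1})]=S_{\rm d}^{*}-S_{\rm d}^{k}(q_k)$. The map $f_k^{+}$ is defined implicitly by $f_k^{+}(q)=D_2H_{\rm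 d}^{+}\big(q,DS_{\rm d}^{k+1}(f_k^{+}(q))\big)$ (assumed solvable).
   Formalization: Existence of the minimum over U_k^1,…,U_k^s in the Bellman equation is assumed (it can fail: the bracket may be unbounded below); the control set is taken open and the data differentiable so that the derivatives make sense, and f_k^+(q) is the unique solution of its implicit equation. *)

theory Defs
  imports "HOL-Analysis.Analysis"
begin

section \<open>Gradients and partial stationarity\<close>

text \<open>
  V is a Euclidean space and the dual of V is identified with V through the inner product, so the
  pairing of p with q is \<open>p \<bullet> q\<close> and derivatives of real functions are gradients.  \<open>grad F x\<close>
  is meaningful only where F is differentiable; the theorem assumes that wherever it uses it.
\<close>

definition grad :: "('a::euclidean_space \<Rightarrow> real) \<Rightarrow> 'a \<Rightarrow> 'a" where
  "grad F x = (THE D. GDERIV F x :> D)"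

definition D1 :: "('v::euclidean_space \<Rightarrow> 'v \<Rightarrow> real) \<Rightarrow> 'v \<Rightarrow> 'v \<Rightarrow> 'v" where
  "D1 H q p = grad (\<lambda>q'. H q' p) q"

definition D2 :: "('v::euclidean_space \<Rightarrow> 'v \<Rightarrow> real) \<Rightarrow> 'v \<Rightarrow> 'v \<Rightarrow> 'v" where
  "D2 H q p = grad (\<lambda>p'. H q p') p"

definition upd :: "'a ^ 's \<Rightarrow> 's \<Rightarrow> 'a \<Rightarrow> 'a ^ 's" where
  "upd X i v = (\<chi> j. if j = i then v else X $ j)"

text \<open>All partial derivatives of F in the s vector-valued arguments exist and vanish at X.\<close>

definition stationary :: "(('a::euclidean_space) ^ 's \<Rightarrow> real) \<Rightarrow> 'a ^ 's \<Rightarrow> bool" where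
  "stationary F X \<longleftrightarrow> (\<forall>i. GDERIV (\<lambda>v. F (upd X i v)) (X $ i) :> 0)"

text \<open>m is the minimum of F over A, in particular attained.\<close>

definition is_minimum :: "('a \<Rightarrow> real) \<Rightarrow> 'a set \<Rightarrow> real \<Rightarrow> bool" where
  "is_minimum F A m \<longleftrightarrow> (\<exists>X\<in>A. F X = m) \<and> (\<forall>X\<in>A. m \<le> F X)"


section \<open>The Galerkin discretization\<close>

record ('v, 'u, 's) galerkin =
  dyn :: "'v \<Rightarrow> 'u \<Rightarrow> 'v"
  cost :: "'v \<Rightarrow> 'u \<Rightarrow> real"
  controls :: "'u set"
  time_step :: real
  basis_fun :: "'s \<Rightarrow> real \<Rightarrow> real"
  weight :: "'s \<Rightarrow> real"
  node :: "'s \<Rightarrow> real"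

text \<open>
  The set of controls is open so that derivatives with respect to the controls make sense on it.
\<close>

definition admissible_data ::
  "('v::euclidean_space, 'u::euclidean_space, 's::finite) galerkin \<Rightarrow> bool" where
  "admissible_data G \<longleftrightarrow>
     0 < time_step G \<and>
     open (controls G) \<and>
     (\<forall>x. \<forall>u\<in>controls G. (\<lambda>(x, u). dyn G x u) differentiable (at (x, u))) \<and>
     (\<forall>x. \<forall>u\<in>controls G. (\<lambda>(x, u). cost G x u) differentiable (at (x, u))) \<and>
     (\<forall>i. basis_fun G i integrable_on {0..1}) \<and>
     (\<forall>a. (\<forall>\<tau>\<in>{0..1}. (\<Sum>i\<in>UNIV. a i * basis_fun G i \<tau>) = 0) \<longrightarrow> (\<forall>i. a i = 0)) \<and>
     (\<forall>i. node G i \<in> {0..1}) \<and>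
     (\<forall>i. weight G i \<noteq> 0)"

definition Bcoef :: "('v, 'u, 's) galerkin \<Rightarrow> 's \<Rightarrow> real" where
  "Bcoef G i = integral {0..1} (basis_fun G i)"

definition Acoef :: "('v, 'u, 's) galerkin \<Rightarrow> 's \<Rightarrow> 's \<Rightarrow> real" where
  "Acoef G i j = integral {0..node G i} (basis_fun G j)"

definition Mcoef :: "('v, 'u, 's) galerkin \<Rightarrow> 's \<Rightarrow> 's \<Rightarrow> real" where
  "Mcoef G i j = basis_fun G j (node G i)"

definition stage_controls :: "('v, 'u, 's::finite) galerkin \<Rightarrow> ('u ^ 's) set" where
  "stage_controls G = {U. \<forall>i. U $ i \<in> controls G}"

definition stage ::
  "('v::euclidean_space, 'u, 's::finite) galerkin \<Rightarrow> 'v \<Rightarrow> 'v ^ 's \<Rightarrow> 's \<Rightarrow> 'v" where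
  "stage G q w i = q + time_step G *\<^sub>R (\<Sum>j\<in>UNIV. Acoef G i j *\<^sub>R w $ j)"

definition Kfun ::
  "('v::euclidean_space, 'u, 's::finite) galerkin
     \<Rightarrow> 'v \<Rightarrow> 'v \<Rightarrow> 'u ^ 's \<Rightarrow> 'v ^ 's \<Rightarrow> 'v ^ 's \<Rightarrow> real" where
  "Kfun G q p U w P =
     p \<bullet> (q + time_step G *\<^sub>R (\<Sum>i\<in>UNIV. Bcoef G i *\<^sub>R w $ i))
     - time_step G * (\<Sum>i\<in>UNIV. weight G i *
         (P $ i \<bullet> ((\<Sum>j\<in>UNIV. Mcoef G i j *\<^sub>R w $ j) - dyn G (stage G q w i) (U $ i))
          + cost G (stage G q w i) (U $ i)))"

text \<open>
  The stationarity conditions of K in P determine w as a function of the state and the stage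
  controls; those in w then determine P.
\<close>

definition solves_stationarity ::
  "('v::euclidean_space, 'u, 's::finite) galerkin
     \<Rightarrow> ('v \<Rightarrow> 'u ^ 's \<Rightarrow> 'v ^ 's) \<Rightarrow> ('v \<Rightarrow> 'v \<Rightarrow> 'u ^ 's \<Rightarrow> 'v ^ 's) \<Rightarrow> bool" where
  "solves_stationarity G wt Pt \<longleftrightarrow>
     (\<forall>q p. \<forall>U\<in>stage_controls G.
        (\<forall>w P. stationary (\<lambda>P'. Kfun G q p U w P') P \<longleftrightarrow> w = wt q U) \<and>
        (\<forall>P. stationary (\<lambda>w'. Kfun G q p U w' P) (wt q U) \<longleftrightarrow> P = Pt q p U))"

text \<open>The Galerkin discrete control Hamiltonian is the value of K at its stationary point.\<close>

definition Hhat ::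
  "('v::euclidean_space, 'u, 's::finite) galerkin
     \<Rightarrow> ('v \<Rightarrow> 'u ^ 's \<Rightarrow> 'v ^ 's) \<Rightarrow> ('v \<Rightarrow> 'v \<Rightarrow> 'u ^ 's \<Rightarrow> 'v ^ 's)
     \<Rightarrow> 'v \<Rightarrow> 'v \<Rightarrow> 'u ^ 's \<Rightarrow> real" where
  "Hhat G wt Pt q p U = Kfun G q p U (wt q U) (Pt q p U)"

definition fd ::
  "('v::euclidean_space, 'u, 's::finite) galerkin
     \<Rightarrow> ('v \<Rightarrow> 'u ^ 's \<Rightarrow> 'v ^ 's) \<Rightarrow> 'v \<Rightarrow> 'u ^ 's \<Rightarrow> 'v" where
  "fd G wt q U = q + time_step G *\<^sub>R (\<Sum>i\<in>UNIV. Bcoef G i *\<^sub>R wt q U $ i)"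

definition Cd ::
  "('v::euclidean_space, 'u, 's::finite) galerkin
     \<Rightarrow> ('v \<Rightarrow> 'u ^ 's \<Rightarrow> 'v ^ 's) \<Rightarrow> 'v \<Rightarrow> 'u ^ 's \<Rightarrow> real" where
  "Cd G wt q U =
     time_step G * (\<Sum>i\<in>UNIV. weight G i * cost G (stage G q (wt q U) i) (U $ i))"

text \<open>Used only under the assumption that the supremum is attained, hence a maximum.\<close>

definition Hplus ::
  "('v::euclidean_space, 'u, 's::finite) galerkin
     \<Rightarrow> ('v \<Rightarrow> 'u ^ 's \<Rightarrow> 'v ^ 's) \<Rightarrow> ('v \<Rightarrow> 'v \<Rightarrow> 'u ^ 's \<Rightarrow> 'v ^ 's)
     \<Rightarrow> 'v \<Rightarrow> 'v \<Rightarrow> real" where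
  "Hplus G wt Pt q p = (SUP U\<in>stage_controls G. Hhat G wt Pt q p U)"


section \<open>Discrete Hamilton--Jacobi theory\<close>

definition discrete_hamilton ::
  "('v::euclidean_space \<Rightarrow> 'v \<Rightarrow> real) \<Rightarrow> nat \<Rightarrow> (nat \<Rightarrow> 'v) \<Rightarrow> (nat \<Rightarrow> 'v) \<Rightarrow> bool" where
  "discrete_hamilton H k qs ps \<longleftrightarrow>
     (\<forall>l<k. qs (Suc l) = D2 H (qs l) (ps (Suc l)) \<and> ps l = D1 H (qs l) (ps (Suc l)))"

definition action_sum ::
  "('v::euclidean_space \<Rightarrow> 'v \<Rightarrow> real) \<Rightarrow> nat \<Rightarrow> (nat \<Rightarrow> 'v) \<Rightarrow> (nat \<Rightarrow> 'v) \<Rightarrow> real" where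
  "action_sum H k qs ps = (\<Sum>l<k. ps (Suc l) \<bullet> qs (Suc l) - H (qs l) (ps (Suc l)))"

text \<open>\<open>\<sigma>\<close> is the action sum along a solution from \<open>q0\<close> at time 0 to \<open>x\<close> at time \<open>k\<close>.\<close>

definition is_action_value ::
  "('v::euclidean_space \<Rightarrow> 'v \<Rightarrow> real) \<Rightarrow> 'v \<Rightarrow> nat \<Rightarrow> 'v \<Rightarrow> real \<Rightarrow> bool" where
  "is_action_value H q0 k x \<sigma> \<longleftrightarrow>
     (\<exists>qs ps. discrete_hamilton H k qs ps \<and> qs 0 = q0 \<and> qs k = x \<and> \<sigma> = action_sum H k qs ps)"

definition cost_to_go :: "real \<Rightarrow> (nat \<Rightarrow> 'v \<Rightarrow> real) \<Rightarrow> nat \<Rightarrow> 'v \<Rightarrow> real" where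
  "cost_to_go Sstar S k x = Sstar - S k x"

text \<open>
  \<open>fp k q\<close> is the point defined implicitly by \<open>x = D2 H q (grad (S (Suc k)) x)\<close>.
\<close>

definition implicit_fplus ::
  "('v::euclidean_space \<Rightarrow> 'v \<Rightarrow> real) \<Rightarrow> (nat \<Rightarrow> 'v \<Rightarrow> real)
     \<Rightarrow> (nat \<Rightarrow> 'v \<Rightarrow> 'v) \<Rightarrow> nat \<Rightarrow> 'v \<Rightarrow> bool" where
  "implicit_fplus H S fp k q \<longleftrightarrow> (\<forall>x. x = D2 H q (grad (S (Suc k)) x) \<longleftrightarrow> x = fp k q)"

definition right_discrete_HJ ::
  "('v::euclidean_space \<Rightarrow> 'v \<Rightarrow> real) \<Rightarrow> (nat \<Rightarrow> 'v \<Rightarrow> real)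
     \<Rightarrow> (nat \<Rightarrow> 'v \<Rightarrow> 'v) \<Rightarrow> nat \<Rightarrow> 'v \<Rightarrow> bool" where
  "right_discrete_HJ H S fp k q \<longleftrightarrow>
     S (Suc k) (fp k q) - S k q - grad (S (Suc k)) (fp k q) \<bullet> fp k q
       + H q (grad (S (Suc k)) (fp k q)) = 0"

end

theory Submission
  imports Defs
begin

text \<open>
  Idea: at a minimizer \<open>U0\<close> of the Bellman expression the gradients with respect to the controls
  vanish; by the chain rule this says that \<open>U0\<close> is stationary for the control Hamiltonian with the
  momentum \<open>p0 = DS (fd q U0)\<close>, so \<open>U0\<close> is the optimal control for \<open>p0\<close>.  By the envelope
  theorem \<open>D2 H q p0 = fd q U0\<close>, so \<open>fd q U0\<close> solves the equation that defines \<open>fplus k q\<close>, and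
  the Hamilton--Jacobi equation at this point evaluates the minimum.
\<close>

lemma GDERIV_unique:
  fixes F :: "'a::euclidean_space \<Rightarrow> real"
  assumes "GDERIV F x :> D" "GDERIV F x :> E"
  shows "D = E"
proof -
  have "(\<lambda>h. h \<bullet> D) = (\<lambda>h. h \<bullet> E)"
    using assms unfolding gderiv_def by (rule has_derivative_unique)
  then have "h \<bullet> D = h \<bullet> E" for h
    by (rule fun_cong)
  then show ?thesis
    by (rule vector_eq_ldot[THEN iffD1, OF allI])
qed

lemma grad_eqI:
  fixes F :: "'a::euclidean_space \<Rightarrow> real"
  assumes "GDERIV F x :> D"
  shows "grad F x = D"
  unfolding grad_def using assms GDERIV_unique by blast

text \<open>Riesz representation: \<open>adjoint F' 1\<close> is the vector that represents the
  functional \<open>F'\<close>.\<close>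

lemma GDERIV_grad:
  fixes F :: "'a::euclidean_space \<Rightarrow> real"
  assumes "F differentiable (at x)"
  shows "GDERIV F x :> grad F x"
proof -
  obtain F' where F': "(F has_derivative F') (at x)"
    using assms unfolding differentiable_def by blast
  have "F' = (\<lambda>h. h \<bullet> adjoint F' 1)"
    using adjoint_works[OF has_derivative_linear[OF F'], of _ 1] by (auto simp: fun_eq_iff)
  then have "GDERIV F x :> adjoint F' 1"
    using F' unfolding gderiv_def by simp
  then show ?thesis
    using grad_eqI by metis
qed

text \<open>The affine function \<open>p \<bullet> a - c\<close> touches \<open>H\<close> from below
  at \<open>p0\<close>, so the difference is minimal there and its derivative vanishes. In the
  application the affine function is the control Hamiltonian of one fixed control.\<close>

lemma envelope_grad:
  fixes H :: "'a::euclidean_space \<Rightarrow> real"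
  assumes "H differentiable (at p0)"
    and ge: "\<And>p. p \<bullet> a - c \<le> H p"
    and eq: "H p0 = p0 \<bullet> a - c"
  shows "grad H p0 = a"
proof -
  define D where "D = grad H p0"
  have "(H has_derivative (\<lambda>h. h \<bullet> D)) (at p0)"
    using GDERIV_grad[OF assms(1)] unfolding gderiv_def D_def .
  then have "((\<lambda>p. H p - (p \<bullet> a - c)) has_derivative (\<lambda>h. h \<bullet> D - h \<bullet> a)) (at p0)"
    by (auto intro!: derivative_eq_intros)
  then have "(\<lambda>h. h \<bullet> D - h \<bullet> a) = (\<lambda>h. 0)"
    by (rule differential_zero_maxmin[of p0 UNIV, rotated 2]) (use ge eq in auto)
  then have "h \<bullet> D = h \<bullet> a" for h
    by (metis eq_iff_diff_eq_0)
  then show ?thesis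
    unfolding D_def by (rule vector_eq_ldot[THEN iffD1, OF allI])
qed

lemma upd_same: "upd X i (X $ i) = X"
  by (simp add: upd_def vec_eq_iff)

lemma upd_has_derivative:
  fixes X :: "'a::euclidean_space ^ 's::finite"
  shows "(upd X i has_derivative (\<lambda>h. axis i h)) (at v)"
proof -
  have "bounded_linear (axis i :: 'a \<Rightarrow> 'a ^ 's)"
    by (intro linear_conv_bounded_linear[THEN iffD1] linearI) (auto simp: axis_def vec_eq_iff)
  then have "((\<lambda>v. upd X i 0 + axis i v) has_derivative (\<lambda>h. 0 + axis i h)) (at v)"
    by (intro has_derivative_add has_derivative_const bounded_linear_imp_has_derivative)
  moreover have "upd X i = (\<lambda>v. upd X i 0 + axis i v)"
    by (auto simp: fun_eq_iff upd_def axis_def vec_eq_iff)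
  ultimately show ?thesis
    by simp
qed

text \<open>The extremum argument yields a total derivative, whereas \<open>stationary\<close>
  varies one argument at a time; composing with the affine map \<open>upd X i\<close> leads from one
  to the other.\<close>

lemma stationaryI:
  fixes F :: "'a::euclidean_space ^ 's::finite \<Rightarrow> real"
  assumes "(F has_derivative (\<lambda>_. 0)) (at X)"
  shows "stationary F X"
  unfolding stationary_def
proof
  fix i
  have "((\<lambda>v. F (upd X i v)) has_derivative (\<lambda>h. 0)) (at (X $ i))"
    by (rule has_derivative_compose[OF upd_has_derivative]) (simp add: upd_same assms)
  then show "GDERIV (\<lambda>v. F (upd X i v)) (X $ i) :> 0"
    by (simp add: gderiv_def)
qed

lemma open_stage_controls: "open (controls G) \<Longrightarrow> open (stage_controls G)"
  unfolding stage_controls_def by (rule open_vector_box) simp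

text \<open>\<open>Kfun\<close> is affine in each stage momentum, with slope minus
  \<open>time_step G * weight G i\<close> times the residual of the stage equation. Both factors are
  nonzero, so stationarity forces the residual to vanish.\<close>

lemma stage_equation:
  fixes G :: "('v::euclidean_space, 'u::euclidean_space, 's::finite) galerkin"
  assumes data: "admissible_data G"
    and Galerkin: "solves_stationarity G wt Pt"
    and U: "U \<in> stage_controls G"
  shows "(\<Sum>j\<in>UNIV. Mcoef G i j *\<^sub>R wt q U $ j) = dyn G (stage G q (wt q U) i) (U $ i)"
proof -
  define w where "w = wt q U"
  define r where
    "r i = (\<Sum>j\<in>UNIV. Mcoef G i j *\<^sub>R w $ j) - dyn G (stage G q w i) (U $ i)" for i
  \<comment> \<open>For \<open>w = wt q U\<close> stationarity holds at all momenta \<open>p\<close>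
    and \<open>P\<close>; taking both to be zero leaves only the term of index \<open>i\<close> and
    a constant.\<close>
  define K where "K = (\<lambda>v. Kfun G q 0 U w (upd 0 i v))"
  have "stationary (\<lambda>P'. Kfun G q 0 U w P') 0"
    using Galerkin U unfolding solves_stationarity_def w_def by blast
  then have K0: "GDERIV K 0 :> 0"
    unfolding stationary_def K_def by (metis zero_index)
  define e where
    "e = time_step G * (\<Sum>j\<in>UNIV. weight G j * cost G (stage G q w j) (U $ j))"
  have "K = (\<lambda>v. - (v \<bullet> ((time_step G * weight G i) *\<^sub>R r i)) - e)"
  proof
    fix v
    have "(\<Sum>j\<in>UNIV. weight G j * (upd 0 i v $ j \<bullet> r j))
        = (\<Sum>j\<in>UNIV. if j = i then weight G i * (v \<bullet> r i) else 0)"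
      by (rule sum.cong) (auto simp: upd_def)
    then show "K v = - (v \<bullet> ((time_step G * weight G i) *\<^sub>R r i)) - e"
      unfolding K_def Kfun_def r_def[symmetric] e_def
      by (simp add: distrib_left sum.distrib)
  qed
  then have "GDERIV K 0 :> - ((time_step G * weight G i) *\<^sub>R r i)"
    unfolding gderiv_def by (auto intro!: derivative_eq_intros)
  then have "(time_step G * weight G i) *\<^sub>R r i = 0"
    using GDERIV_unique[OF K0] by force
  then have "r i = 0"
    using data unfolding admissible_data_def by auto
  then show ?thesis
    unfolding r_def w_def by simp
qed

text \<open>The bracket paired with each stage momentum is zero by the stage equations, so
  \<open>Pt\<close> drops out.\<close>

lemma Hhat_eq:
  fixes G :: "('v::euclidean_space, 'u::euclidean_space, 's::finite) galerkin"
  assumes "admissible_data G" "solves_stationarity G wt Pt" "U \<in> stage_controls G"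
  shows "Hhat G wt Pt q p U = p \<bullet> fd G wt q U - Cd G wt q U"
  by (simp add: Hhat_def Kfun_def fd_def Cd_def stage_equation[OF assms])

lemma fd_differentiable:
  fixes G :: "('v::euclidean_space, 'u::euclidean_space, 's::finite) galerkin"
  assumes "wt q differentiable (at U)"
  shows "fd G wt q differentiable (at U)"
  unfolding fd_def
  by (intro differentiable_add differentiable_const differentiable_scaleR differentiable_sum finite
      differentiable_compose[OF _ assms, of "\<lambda>w. w $ _"] ballI
      linear_imp_differentiable bounded_linear.linear[OF bounded_linear_vec_nth])

text \<open>The controls enter \<open>cost\<close> directly and through the stages, so the chain
  rule is applied to \<open>cost\<close> as a function of the pair.\<close>

lemma Cd_differentiable:
  fixes G :: "('v::euclidean_space, 'u::euclidean_space, 's::finite) galerkin"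
  assumes data: "admissible_data G"
    and U: "U \<in> stage_controls G"
    and wt: "wt q differentiable (at U)"
  shows "Cd G wt q differentiable (at U)"
proof -
  obtain w' where w': "(wt q has_derivative w') (at U)"
    using wt unfolding differentiable_def by blast
  have "(\<lambda>U. cost G (stage G q (wt q U) i) (U $ i)) differentiable (at U)" for i
  proof -
    have "U $ i \<in> controls G"
      using U unfolding stage_controls_def by simp
    then have "(\<lambda>(x, u). cost G x u) differentiable (at (stage G q (wt q U) i, U $ i))"
      using data unfolding admissible_data_def by blast
    then obtain c' where c': "((\<lambda>(x, u). cost G x u) has_derivative c')
        (at (stage G q (wt q U) i, U $ i))"
      unfolding differentiable_def by blast
    have "((\<lambda>U. stage G q (wt q U) i) has_derivative
        (\<lambda>h. time_step G *\<^sub>R (\<Sum>j\<in>UNIV. Acoef G i j *\<^sub>R w' h $ j))) (at U)"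
      unfolding stage_def
      by (auto intro!: derivative_eq_intros bounded_linear.has_derivative[OF bounded_linear_vec_nth] w')
    then have "((\<lambda>U. (stage G q (wt q U) i, U $ i)) has_derivative
        (\<lambda>h. (time_step G *\<^sub>R (\<Sum>j\<in>UNIV. Acoef G i j *\<^sub>R w' h $ j), h $ i))) (at U)"
      by (intro has_derivative_Pair bounded_linear_imp_has_derivative bounded_linear_vec_nth)
    from has_derivative_compose[OF this c'] show ?thesis
      unfolding differentiable_def by auto
  qed
  then show ?thesis
    unfolding Cd_def by (intro differentiable_mult differentiable_const differentiable_sum finite ballI)
qed

lemma Hplus_eq:
  assumes "is_arg_max (Hhat G wt Pt q p) (\<lambda>U. U \<in> stage_controls G) U0"
  shows "Hplus G wt Pt q p = Hhat G wt Pt q p U0"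
  unfolding Hplus_def
  using assms by (intro cSup_eq_maximum) (auto simp: is_arg_max_linorder)

lemma Hhat_le_Hplus:
  assumes "is_arg_max (Hhat G wt Pt q p) (\<lambda>U. U \<in> stage_controls G) U0"
    and "U \<in> stage_controls G"
  shows "Hhat G wt Pt q p U \<le> Hplus G wt Pt q p"
  using assms by (simp add: Hplus_eq is_arg_max_linorder)

text \<open>By the chain rule, the derivative of \<open>V\<close> along \<open>fd\<close> at
  \<open>U0\<close> equals that of \<open>p \<bullet> fd\<close> with \<open>p\<close> frozen at the
  gradient of \<open>V\<close>. The first-order condition at the minimum is therefore, up to sign,
  the one for the control Hamiltonian at this \<open>p\<close>.\<close>

lemma stationary_Hhat_if_minimum:
  fixes G :: "('v::euclidean_space, 'u::euclidean_space, 's::finite) galerkin"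
  assumes data: "admissible_data G"
    and Galerkin: "solves_stationarity G wt Pt"
    and U0: "U0 \<in> stage_controls G"
    and wt: "wt q differentiable (at U0)"
    and V: "V differentiable (at (fd G wt q U0))"
    and min: "\<And>U. U \<in> stage_controls G \<Longrightarrow>
      Cd G wt q U0 - V (fd G wt q U0) \<le> Cd G wt q U - V (fd G wt q U)"
  shows "stationary (Hhat G wt Pt q (grad V (fd G wt q U0))) U0"
proof -
  define p where "p = grad V (fd G wt q U0)"
  have op: "open (stage_controls G)"
    using data open_stage_controls unfolding admissible_data_def by blast
  obtain f' where f': "(fd G wt q has_derivative f') (at U0)"
    using fd_differentiable[where wt = wt, OF wt] unfolding differentiable_def by blast
  obtain c' where c': "(Cd G wt q has_derivative c') (at U0)"
    using Cd_differentiable[where wt = wt, OF data U0 wt] unfolding differentiable_def by blast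
  have V': "(V has_derivative (\<lambda>h. h \<bullet> p)) (at (fd G wt q U0))"
    using GDERIV_grad[OF V] unfolding gderiv_def p_def .
  have "((\<lambda>U. Cd G wt q U - V (fd G wt q U)) has_derivative (\<lambda>h. c' h - f' h \<bullet> p)) (at U0)"
    by (intro has_derivative_diff c' has_derivative_compose[OF f' V'])
  then have "(\<lambda>h. c' h - f' h \<bullet> p) = (\<lambda>h. 0)"
    by (rule differential_zero_maxmin[OF U0 op]) (use min in blast)
  then have "(\<lambda>h. p \<bullet> f' h - c' h) = (\<lambda>h. 0)"
    by (metis (no_types, opaque_lifting) eq_iff_diff_eq_0 inner_commute)
  moreover have "((\<lambda>U. p \<bullet> fd G wt q U - Cd G wt q U) has_derivative (\<lambda>h. p \<bullet> f' h - c' h)) (at U0)"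
    by (intro has_derivative_diff c' has_derivative_inner_right f')
  ultimately have "((\<lambda>U. p \<bullet> fd G wt q U - Cd G wt q U) has_derivative (\<lambda>h. 0)) (at U0)"
    by simp
  \<comment> \<open>\<open>Hhat_eq\<close> is available only for admissible controls; these form an
    open set around \<open>U0\<close>, which suffices for derivatives.\<close>
  then have "(Hhat G wt Pt q p has_derivative (\<lambda>h. 0)) (at U0)"
    by (rule has_derivative_transform_within_open[OF _ op U0])
      (simp add: Hhat_eq[OF data Galerkin])
  then show ?thesis
    unfolding p_def by (rule stationaryI)
qed

theorem mainTheorem6:
  fixes G :: "('v::euclidean_space, real ^ 'm, 's::finite) galerkin"
    and wt :: "'v \<Rightarrow> (real ^ 'm) ^ 's \<Rightarrow> 'v ^ 's"
    and Pt :: "'v \<Rightarrow> 'v \<Rightarrow> (real ^ 'm) ^ 's \<Rightarrow> 'v ^ 's"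
    and Ustar :: "'v \<Rightarrow> 'v \<Rightarrow> (real ^ 'm) ^ 's"
    and S :: "nat \<Rightarrow> 'v \<Rightarrow> real"
    and fplus :: "nat \<Rightarrow> 'v \<Rightarrow> 'v"
    and q0 qT q :: 'v
    and Sstar :: real
    and k N :: nat
  assumes data: "admissible_data G"
    and Galerkin: "solves_stationarity G wt Pt"
    and wt_smooth: "\<And>x U. U \<in> stage_controls G \<Longrightarrow> wt x differentiable (at U)"
    and Ustar_solves: "\<And>x p U. U \<in> stage_controls G \<Longrightarrow>
          stationary (Hhat G wt Pt x p) U \<longleftrightarrow> U = Ustar x p"
    and Ustar_optimal: "\<And>x p. is_arg_max (Hhat G wt Pt x p) (\<lambda>U. U \<in> stage_controls G) (Ustar x p)"
    and Hplus_smooth: "\<And>x p. (\<lambda>(x, p). Hplus G wt Pt x p) differentiable (at (x, p))"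
    and k: "k < N"
    and S_now: "is_action_value (Hplus G wt Pt) q0 k q (S k q)"
    and S_next: "\<And>x. is_action_value (Hplus G wt Pt) q0 (Suc k) x (S (Suc k) x)"
    and S_next_smooth: "\<And>x. S (Suc k) differentiable (at x)"
    and Sstar: "is_action_value (Hplus G wt Pt) q0 N qT Sstar"
    and fplus: "implicit_fplus (Hplus G wt Pt) S fplus k q"
    and HJ: "right_discrete_HJ (Hplus G wt Pt) S fplus k q"
    and min_exists: "\<exists>m. is_minimum
          (\<lambda>U. cost_to_go Sstar S (Suc k) (fd G wt q U) + Cd G wt q U) (stage_controls G) m"
  shows "is_minimum
          (\<lambda>U. cost_to_go Sstar S (Suc k) (fd G wt q U) + Cd G wt q U) (stage_controls G)
          (cost_to_go Sstar S k q)"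
proof -
  obtain U0 where U0: "U0 \<in> stage_controls G"
    and min: "\<And>U. U \<in> stage_controls G \<Longrightarrow>
      cost_to_go Sstar S (Suc k) (fd G wt q U0) + Cd G wt q U0
        \<le> cost_to_go Sstar S (Suc k) (fd G wt q U) + Cd G wt q U"
    using min_exists unfolding is_minimum_def by blast
  define x where "x = fd G wt q U0"
  define p where "p = grad (S (Suc k)) x"
  \<comment> \<open>The constant \<open>Sstar\<close> cancels from both sides of \<open>min\<close>,
    leaving the minimum condition for \<open>V = S (Suc k)\<close>.\<close>
  have "stationary (Hhat G wt Pt q p) U0"
    unfolding p_def x_def
    using min by (intro stationary_Hhat_if_minimum data Galerkin U0 wt_smooth S_next_smooth)
      (fastforce simp: cost_to_go_def)
  \<comment> \<open>Uniqueness of the stationary point turns a critical point into the global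
    maximizer for the momentum \<open>p\<close>.\<close>
  then have U0_opt: "U0 = Ustar q p"
    using Ustar_solves U0 by blast
  have Hplus_p: "Hplus G wt Pt q p = p \<bullet> x - Cd G wt q U0"
    using Hplus_eq[OF Ustar_optimal, of q p] Hhat_eq[OF data Galerkin U0]
    unfolding U0_opt[symmetric] x_def by simp
  \<comment> \<open>For momenta other than \<open>p\<close>, the control \<open>U0\<close> serves
    only as a competitor in the maximum.\<close>
  have Hplus_ge: "p' \<bullet> x - Cd G wt q U0 \<le> Hplus G wt Pt q p'" for p'
    using Hhat_le_Hplus[OF Ustar_optimal U0] Hhat_eq[OF data Galerkin U0]
    unfolding x_def by metis
  have "(\<lambda>p'. (\<lambda>(x, p). Hplus G wt Pt x p) (q, p')) differentiable (at p)"
    by (rule differentiable_compose[of "\<lambda>(x, p). Hplus G wt Pt x p"])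
      (auto intro: Hplus_smooth differentiable_Pair)
  then have "D2 (Hplus G wt Pt) q p = x"
    unfolding D2_def using Hplus_ge Hplus_p by (intro envelope_grad) auto
  \<comment> \<open>Since \<open>p\<close> is the gradient of \<open>S (Suc k)\<close> at
    \<open>x\<close>, the point \<open>x\<close> satisfies the implicit equation, whose only
    solution is \<open>fplus k q\<close>.\<close>
  then have x: "fplus k q = x"
    using fplus unfolding implicit_fplus_def p_def by metis
  \<comment> \<open>Inserting \<open>Hplus_p\<close> cancels the two pairings
    \<open>p \<bullet> x\<close> in the Hamilton-Jacobi equation.\<close>
  have "S (Suc k) x - S k q - Cd G wt q U0 = 0"
    using HJ Hplus_p unfolding right_discrete_HJ_def x p_def[symmetric] by simp
  then have "cost_to_go Sstar S (Suc k) (fd G wt q U0) + Cd G wt q U0 = cost_to_go Sstar S k q"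
    unfolding cost_to_go_def x_def by simp
  then show ?thesis
    unfolding is_minimum_def using U0 min by auto
qed

end
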